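(* Let $\mathcal{T}$ be a TBox, let $\Sigma\subseteq\mathrm{sig}(\mathcal{T})$ be a signature, and let $\chi_{\mathsf m}=\langle\theta^{\mathsf m},\mathcal{A}_0^{\mathsf m},\mathcal{A}_r^{\mathsf m}\rangle$ be the module setting for $\mathcal{T}$ and $\Sigma$ defined in the context. Then $\mathcal{M}^{\chi_{\mathsf m}}\equiv^{\mathsf m}_\Sigma\mathcal{T}$, i.e. $\mathcal{M}^{\chi_{\mathsf m}}$ is $\Sigma$-model inseparable from $\mathcal{T}$: for every model $\mathcal{I}$ of $\mathcal{M}^{\chi_{\mathsf m}}$ (resp. of $\mathcal{T}$) there exists a model $\mathcal{J}$ of $\mathcal{T}$ (resp. of $\mathcal{M}^{\chi_{\mathsf m}}$) with the same domain such that $A^{\mathcal{I}}=A^{\mathcal{J}}$ for each $A\in\Sigma$.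
   Context: Rules and TBoxes. Standard first-order logic is used. A signature is a set of predicates; $\mathrm{sig}(F)$ is the signature of a set of formulas $F$; the nullary falsehood predicate $\bot$ is assumed to belong to every signature. A rule is a function-free sentence $\forall\mathbf{x}.[\varphi(\mathbf{x})\to\exists\mathbf{y}.[\bigvee_{i=1}^n\psi_i(\mathbf{x},\mathbf{y})]]$ with the body $\varphi$ and the $\psi_i$ conjunctions of distinct atoms ($n\ge 0$; for $n=0$ the head is the empty disjunction, i.e. $\bot$). Rules are safe (all universally quantified variables in the head occur in the body), and w.l.o.g. the truth symbol $\top$ does not occur in rule heads and $\bot$ does not occur in rule bodies. Universal quantifiers are usually omitted. A TBox is a finite set of rules; TBoxes mentioning equality are extended with its standard axiomatisation. A fact is a function-free ground atom; an ABox is a finite set of facts; a $\Sigma$-ABox is an ABox over the predicates of $\Sigma$. Standing assumptions: $\mathcal{T}$ contains no constants and rules in $\mathcal{T}$ do not share existentially quantified variables. Datalog. A rule is datalog if its head has at most one atom and all variables are universally quantified; a datalog program $\mathcal{P}$ is a set of datalog rules. A fact $\gamma$ is a consequence of a datalog rule $\bigwedge_{i=1}^n\gamma_i'\to\delta$ and facts $\gamma_1,\dots,\gamma_n$ if $\gamma=\delta\sigma$ with $\sigma$ a most general unifier of $\gamma_i,\gamma_i'$ for each $1\le i\le n$. A proof of $\gamma$ in $\mathcal{P}\cup\mathcal{A}$ ($\mathcal{A}$ an ABox) is a pair $(T,\lambda)$ with $T$ a tree and $\lambda$ mapping nodes of $T$ to facts and edges of $T$ to rules of $\mathcal{P}$,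 such that for each node $v$: (1) $\lambda(v)=\gamma$ if $v$ is the root; (2) $\lambda(v)\in\mathcal{A}$ if $v$ is a leaf; (3) if $v$ has children $w_1,\dots,w_n$, then all edges from $v$ to the $w_i$ are labelled by the same rule $r$ and $\lambda(v)$ is a consequence of $r$ and $\lambda(w_1),\dots,\lambda(w_n)$. The support of $\gamma$ is the set of rules occurring in some proof of $\gamma$ in $\mathcal{P}\cup\mathcal{A}$. Module settings. A module setting for $\mathcal{T}$ and $\Sigma$ is a tuple $\chi=\langle\theta,\mathcal{A}_0,\mathcal{A}_r\rangle$ with $\theta$ a substitution from the existentially quantified variables of $\mathcal{T}$ to constants, $\mathcal{A}_0$ a $\Sigma$-ABox, $\mathcal{A}_r$ a $\mathrm{sig}(\mathcal{T})$-ABox, and such that no constant in $\chi$ occurs in $\mathcal{T}$. The program $\mathcal{P}^\chi$ is the smallest datalog program containing, for each rule $\varphi(\mathbf{x})\to\exists\mathbf{y}.[\bigvee_{i=1}^n\psi_i(\mathbf{x},\mathbf{y})]$ in $\mathcal{T}$, the following corresponding datalog rules: $\varphi\to\bot$ if $n=0$, and $\varphi\to\gamma\theta$ for each $1\le i\le n$ and each atom $\gamma$ in $\psi_i$. The support of $\chi$ is the set of rules of $\mathcal{P}^\chi$ that support a fact from $\mathcal{A}_r$ in $\mathcal{P}^\chi\cup\mathcal{A}_0$. The module $\mathcal{M}^\chi$ is the set of rules in $\mathcal{T}$ that have a corresponding datalog rule in the support of $\chi$. The setting $\chi_{\mathsf m}$. Let $\ast$ be a fresh constant. Then $\theta^{\mathsf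 m}$ maps each existentially quantified variable of $\mathcal{T}$ to $\ast$, and $\mathcal{A}_0^{\mathsf m}=\mathcal{A}_r^{\mathsf m}=\{A(\ast,\dots,\ast)\mid A\in\Sigma\}$. *)

theory Defs
  imports Main
begin

section \<open>Syntax\<close>

text \<open>
  A predicate symbol carries its arity. The falsehood predicate \<open>Bot\<close> is nullary. Equality \<open>Eq\<close>
  is an ordinary binary predicate without a built-in meaning: it is governed only by the rules
  \<open>eq_axioms\<close> below.
\<close>

datatype 'p psym = Bot | Eq | Pred 'p nat

fun arity :: "'p psym \<Rightarrow> nat" where
  "arity Bot = 0"
| "arity Eq = 2"
| "arity (Pred p n) = n"

type_synonym var = nat

datatype 'c trm = Var var | Const 'c

text \<open>
  The truth symbol is a logical symbol and not a predicate; in particular it belongs to no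
  signature. It may take any number of arguments, so that both the nullary truth constant and the
  form \<open>Top [x]\<close>, which makes a rule safe without restricting \<open>x\<close>, are available.
\<close>

datatype ('p, 'c) atom = Top "'c trm list" | Atom "'p psym" "'c trm list"

fun args :: "('p, 'c) atom \<Rightarrow> 'c trm list" where
  "args (Top ts) = ts"
| "args (Atom A ts) = ts"

fun preds :: "('p, 'c) atom \<Rightarrow> 'p psym set" where
  "preds (Top ts) = {}"
| "preds (Atom A ts) = {A}"

fun wf_atom :: "('p, 'c) atom \<Rightarrow> bool" where
  "wf_atom (Top ts) \<longleftrightarrow> True"
| "wf_atom (Atom A ts) \<longleftrightarrow> length ts = arity A"

definition is_top :: "('p, 'c) atom \<Rightarrow> bool" where
  "is_top a \<longleftrightarrow> (\<exists>ts. a = Top ts)"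

definition vars :: "('p, 'c) atom \<Rightarrow> var set" where
  "vars a = {x. Var x \<in> set (args a)}"

definition constants :: "('p, 'c) atom \<Rightarrow> 'c set" where
  "constants a = {c. Const c \<in> set (args a)}"

definition ground :: "('p, 'c) atom \<Rightarrow> bool" where
  "ground a \<longleftrightarrow> vars a = {}"

text \<open>
  The rule with body \<open>[\<phi>\<^sub>1, \<dots>, \<phi>\<^sub>m]\<close>, existential variables \<open>y\<close> and head
  \<open>[\<psi>\<^sub>1, \<dots>, \<psi>\<^sub>n]\<close> is the sentence
  \<open>\<forall>x. [\<phi>\<^sub>1 \<and> \<dots> \<and> \<phi>\<^sub>m \<longrightarrow> (\<exists>y. \<psi>\<^sub>1 \<or> \<dots> \<or> \<psi>\<^sub>n)]\<close>, where each \<open>\<psi>\<^sub>i\<close> is the list of the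
  conjuncts of a conjunction and \<open>x\<close> are all variables other than \<open>y\<close>.
\<close>

datatype ('p, 'c) rule =
  Rule (body: "('p, 'c) atom list") (evars: "var list") (head: "('p, 'c) atom list list")

definition body_atoms :: "('p, 'c) rule \<Rightarrow> ('p, 'c) atom set" where
  "body_atoms r = set (body r)"

definition head_atoms :: "('p, 'c) rule \<Rightarrow> ('p, 'c) atom set" where
  "head_atoms r = (\<Union>\<psi>\<in>set (head r). set \<psi>)"

definition rule_atoms :: "('p, 'c) rule \<Rightarrow> ('p, 'c) atom set" where
  "rule_atoms r = body_atoms r \<union> head_atoms r"

definition safe :: "('p, 'c) rule \<Rightarrow> bool" where
  "safe r \<longleftrightarrow> (\<Union>a\<in>head_atoms r. vars a) - set (evars r) \<subseteq> (\<Union>a\<in>body_atoms r. vars a)"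

text \<open>
  Conjunctions are nonempty; the trivially true body is \<open>[Top []]\<close>.
\<close>

definition wf_rule :: "('p, 'c) rule \<Rightarrow> bool" where
  "wf_rule r \<longleftrightarrow>
     body r \<noteq> [] \<and> distinct (body r) \<and>
     (\<forall>\<psi>\<in>set (head r). \<psi> \<noteq> [] \<and> distinct \<psi>) \<and>
     (\<forall>a\<in>rule_atoms r. wf_atom a) \<and>
     (\<forall>a\<in>body_atoms r. Bot \<notin> preds a) \<and>
     (\<forall>a\<in>head_atoms r. \<not> is_top a) \<and>
     (\<forall>a\<in>body_atoms r. vars a \<inter> set (evars r) = {}) \<and>
     safe r"

definition sig :: "('p, 'c) rule set \<Rightarrow> 'p psym set" where
  "sig T = insert Bot (\<Union>r\<in>T. \<Union>a\<in>rule_atoms r. preds a)"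

definition is_signature :: "'p psym set \<Rightarrow> bool" where
  "is_signature \<Sigma> \<longleftrightarrow> Bot \<in> \<Sigma>"

text \<open>
  Reflexivity, symmetry, transitivity, and congruence for every argument position of every
  predicate of \<open>S\<close>. Congruence for \<open>Eq\<close> itself follows from symmetry and transitivity.
\<close>

definition eq_axioms :: "'p psym set \<Rightarrow> ('p, 'c) rule set" where
  "eq_axioms S =
     {Rule [Top [Var 0]] [] [[Atom Eq [Var 0, Var 0]]],
      Rule [Atom Eq [Var 0, Var 1]] [] [[Atom Eq [Var 1, Var 0]]],
      Rule [Atom Eq [Var 0, Var 1], Atom Eq [Var 1, Var 2]] [] [[Atom Eq [Var 0, Var 2]]]} \<union>
     {Rule [Atom (Pred p n) (map Var [0..<n]), Atom Eq [Var i, Var n]] []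
           [[Atom (Pred p n) ((map Var [0..<n])[i := Var n])]] | p n i. Pred p n \<in> S \<and> i < n}"

definition tbox :: "('p, 'c) rule set \<Rightarrow> bool" where
  "tbox T \<longleftrightarrow> finite T \<and> (\<forall>r\<in>T. wf_rule r) \<and> (Eq \<in> sig T \<longrightarrow> eq_axioms (sig T) \<subseteq> T)"

definition tbox_constants :: "('p, 'c) rule set \<Rightarrow> 'c set" where
  "tbox_constants T = (\<Union>r\<in>T. \<Union>a\<in>rule_atoms r. constants a)"

definition tbox_evars :: "('p, 'c) rule set \<Rightarrow> var set" where
  "tbox_evars T = (\<Union>r\<in>T. set (evars r))"

definition evars_apart :: "('p, 'c) rule set \<Rightarrow> bool" where
  "evars_apart T \<longleftrightarrow> (\<forall>r\<in>T. \<forall>r'\<in>T. r \<noteq> r' \<longrightarrow> set (evars r) \<inter> set (evars r') = {})"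

definition abox :: "'p psym set \<Rightarrow> ('p, 'c) atom set \<Rightarrow> bool" where
  "abox \<Sigma> \<A> \<longleftrightarrow> finite \<A> \<and>
     (\<forall>a\<in>\<A>. \<not> is_top a \<and> preds a \<subseteq> \<Sigma> \<and> wf_atom a \<and> ground a)"


section \<open>Semantics\<close>

record ('p, 'c, 'd) interp =
  Dom :: "'d set"
  cint :: "'c \<Rightarrow> 'd"
  pint :: "'p psym \<Rightarrow> 'd list set"

definition interpretation_wf :: "('p, 'c, 'd) interp \<Rightarrow> bool" where
  "interpretation_wf I \<longleftrightarrow>
     Dom I \<noteq> {} \<and> range (cint I) \<subseteq> Dom I \<and>
     (\<forall>A. pint I A \<subseteq> {ds. set ds \<subseteq> Dom I \<and> length ds = arity A}) \<and>
     pint I Bot = {}"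

fun val :: "('p, 'c, 'd) interp \<Rightarrow> (var \<Rightarrow> 'd) \<Rightarrow> 'c trm \<Rightarrow> 'd" where
  "val I \<nu> (Var x) = \<nu> x"
| "val I \<nu> (Const c) = cint I c"

fun sat_atom :: "('p, 'c, 'd) interp \<Rightarrow> (var \<Rightarrow> 'd) \<Rightarrow> ('p, 'c) atom \<Rightarrow> bool" where
  "sat_atom I \<nu> (Top ts) \<longleftrightarrow> True"
| "sat_atom I \<nu> (Atom A ts) \<longleftrightarrow> map (val I \<nu>) ts \<in> pint I A"

definition sat_rule :: "('p, 'c, 'd) interp \<Rightarrow> ('p, 'c) rule \<Rightarrow> bool" where
  "sat_rule I r \<longleftrightarrow>
     (\<forall>\<nu>. range \<nu> \<subseteq> Dom I \<longrightarrow> (\<forall>a\<in>set (body r). sat_atom I \<nu> a) \<longrightarrow>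
       (\<exists>\<mu>. range \<mu> \<subseteq> Dom I \<and> (\<forall>x. x \<notin> set (evars r) \<longrightarrow> \<mu> x = \<nu> x) \<and>
         (\<exists>\<psi>\<in>set (head r). \<forall>a\<in>set \<psi>. sat_atom I \<mu> a)))"

definition is_model :: "('p, 'c, 'd) interp \<Rightarrow> ('p, 'c) rule set \<Rightarrow> bool" where
  "is_model I T \<longleftrightarrow> interpretation_wf I \<and> (\<forall>r\<in>T. sat_rule I r)"

text \<open>
  Inseparability with respect to interpretations whose domain is a nonempty subset of the type
  \<open>'d\<close>.
\<close>

definition model_inseparable ::
  "'d itself \<Rightarrow> 'p psym set \<Rightarrow> ('p, 'c) rule set \<Rightarrow> ('p, 'c) rule set \<Rightarrow> bool" where
  "model_inseparable D \<Sigma> T T' \<longleftrightarrow>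
     (\<forall>I :: ('p, 'c, 'd) interp. is_model I T \<longrightarrow>
        (\<exists>J :: ('p, 'c, 'd) interp. is_model J T' \<and> Dom J = Dom I \<and> (\<forall>A\<in>\<Sigma>. pint I A = pint J A))) \<and>
     (\<forall>I :: ('p, 'c, 'd) interp. is_model I T' \<longrightarrow>
        (\<exists>J :: ('p, 'c, 'd) interp. is_model J T \<and> Dom J = Dom I \<and> (\<forall>A\<in>\<Sigma>. pint I A = pint J A)))"


section \<open>Datalog\<close>

text \<open>A datalog rule with empty head is represented by the head \<open>Atom Bot []\<close>.\<close>

datatype ('p, 'c) drule = DRule (dbody: "('p, 'c) atom list") (dhead: "('p, 'c) atom")

type_synonym 'c subst = "var \<Rightarrow> 'c trm"

fun subst_trm :: "'c subst \<Rightarrow> 'c trm \<Rightarrow> 'c trm" where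
  "subst_trm \<sigma> (Var x) = \<sigma> x"
| "subst_trm \<sigma> (Const c) = Const c"

fun subst_atom :: "'c subst \<Rightarrow> ('p, 'c) atom \<Rightarrow> ('p, 'c) atom" where
  "subst_atom \<sigma> (Top ts) = Top (map (subst_trm \<sigma>) ts)"
| "subst_atom \<sigma> (Atom A ts) = Atom A (map (subst_trm \<sigma>) ts)"

definition unifier :: "'c subst \<Rightarrow> (('p, 'c) atom \<times> ('p, 'c) atom) list \<Rightarrow> bool" where
  "unifier \<sigma> E \<longleftrightarrow> (\<forall>(a, b)\<in>set E. subst_atom \<sigma> a = subst_atom \<sigma> b)"

definition mgu :: "'c subst \<Rightarrow> (('p, 'c) atom \<times> ('p, 'c) atom) list \<Rightarrow> bool" where
  "mgu \<sigma> E \<longleftrightarrow> unifier \<sigma> E \<and> (\<forall>\<tau>. unifier \<tau> E \<longrightarrow> (\<exists>\<rho>. \<forall>x. \<tau> x = subst_trm \<rho> (\<sigma> x)))"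

definition consequence ::
  "('p, 'c) atom \<Rightarrow> ('p, 'c) drule \<Rightarrow> ('p, 'c) atom list \<Rightarrow> bool" where
  "consequence \<gamma> r \<gamma>s \<longleftrightarrow>
     ground \<gamma> \<and> length \<gamma>s = length (dbody r) \<and>
     (\<exists>\<sigma>. mgu \<sigma> (zip \<gamma>s (dbody r)) \<and> \<gamma> = subst_atom \<sigma> (dhead r))"

text \<open>
  Finite trees whose nodes are labelled with \<open>'f\<close> and whose edges are labelled with \<open>'r\<close>. The
  generated function \<open>edges\<close> yields the set of all edge labels of a tree.
\<close>

datatype (nodes: 'f, edges: 'r) ltree =
  Node (label: 'f) (branches: "('r \<times> ('f, 'r) ltree) list")

text \<open>
  Besides the facts of the ABox, leaves may carry ground atoms over the truth symbol, which hold
  in every ABox.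
\<close>

inductive proof_tree ::
  "('p, 'c) drule set \<Rightarrow> ('p, 'c) atom set \<Rightarrow> (('p, 'c) atom, ('p, 'c) drule) ltree \<Rightarrow> bool"
  for P \<A> where
  leaf: "\<gamma> \<in> \<A> \<or> is_top \<gamma> \<and> ground \<gamma> \<Longrightarrow> proof_tree P \<A> (Node \<gamma> [])"
| inner: "bs \<noteq> [] \<Longrightarrow> r \<in> P \<Longrightarrow>
          (\<And>b. b \<in> set bs \<Longrightarrow> fst b = r) \<Longrightarrow>
          (\<And>b. b \<in> set bs \<Longrightarrow> proof_tree P \<A> (snd b)) \<Longrightarrow>
          consequence \<gamma> r (map (\<lambda>b. label (snd b)) bs) \<Longrightarrow>
          proof_tree P \<A> (Node \<gamma> bs)"

definition fact_support ::
  "('p, 'c) atom \<Rightarrow> ('p, 'c) drule set \<Rightarrow> ('p, 'c) atom set \<Rightarrow> ('p, 'c) drule set" where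
  "fact_support \<gamma> P \<A> = {r. \<exists>t. proof_tree P \<A> t \<and> label t = \<gamma> \<and> r \<in> edges t}"


section \<open>Module settings\<close>

text \<open>
  The substitution \<open>theta\<close> is a total function, of which only the values on the existential
  variables of the TBox matter.
\<close>

record ('p, 'c) setting =
  theta :: "var \<Rightarrow> 'c"
  abox0 :: "('p, 'c) atom set"
  aboxr :: "('p, 'c) atom set"

definition module_setting ::
  "('p, 'c) rule set \<Rightarrow> 'p psym set \<Rightarrow> ('p, 'c) setting \<Rightarrow> bool" where
  "module_setting T \<Sigma> \<chi> \<longleftrightarrow>
     abox \<Sigma> (abox0 \<chi>) \<and> abox (sig T) (aboxr \<chi>) \<and>
     (theta \<chi> ` tbox_evars T \<union> (\<Union>a\<in>abox0 \<chi> \<union> aboxr \<chi>. constants a)) \<inter> tbox_constants T = {}"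

definition inst :: "(var \<Rightarrow> 'c) \<Rightarrow> ('p, 'c) rule \<Rightarrow> ('p, 'c) atom \<Rightarrow> ('p, 'c) atom" where
  "inst \<theta> r = subst_atom (\<lambda>x. if x \<in> set (evars r) then Const (\<theta> x) else Var x)"

definition corresponding :: "(var \<Rightarrow> 'c) \<Rightarrow> ('p, 'c) rule \<Rightarrow> ('p, 'c) drule set" where
  "corresponding \<theta> r =
     (if head r = [] then {DRule (body r) (Atom Bot [])}
      else {DRule (body r) (inst \<theta> r \<gamma>) | \<gamma>. \<gamma> \<in> head_atoms r})"

definition program :: "('p, 'c) rule set \<Rightarrow> ('p, 'c) setting \<Rightarrow> ('p, 'c) drule set" where
  "program T \<chi> = (\<Union>r\<in>T. corresponding (theta \<chi>) r)"

definition setting_support :: "('p, 'c) rule set \<Rightarrow> ('p, 'c) setting \<Rightarrow> ('p, 'c) drule set" where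
  "setting_support T \<chi> =
     {r \<in> program T \<chi>. \<exists>\<gamma>\<in>aboxr \<chi>. r \<in> fact_support \<gamma> (program T \<chi>) (abox0 \<chi>)}"

definition module_of :: "('p, 'c) rule set \<Rightarrow> ('p, 'c) setting \<Rightarrow> ('p, 'c) rule set" where
  "module_of T \<chi> = {r \<in> T. corresponding (theta \<chi>) r \<inter> setting_support T \<chi> \<noteq> {}}"

definition star_abox :: "'p psym set \<Rightarrow> 'c \<Rightarrow> ('p, 'c) atom set" where
  "star_abox \<Sigma> c = {Atom A (replicate (arity A) (Const c)) | A. A \<in> \<Sigma>}"

definition chi_m :: "'p psym set \<Rightarrow> 'c \<Rightarrow> ('p, 'c) setting" where
  "chi_m \<Sigma> c = \<lparr>theta = (\<lambda>_. c), abox0 = star_abox \<Sigma> c, aboxr = star_abox \<Sigma> c\<rparr>"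

lemma finite_sig: "finite T \<Longrightarrow> finite (sig T)"
proof -
  have "finite (preds a)" for a :: "('p, 'c) atom"
    by (cases a) auto
  then show "finite T \<Longrightarrow> finite (sig T)"
    by (auto simp: sig_def rule_atoms_def body_atoms_def head_atoms_def)
qed

lemma module_setting_chi_m:
  assumes "finite T" "\<Sigma> \<subseteq> sig T" "c \<notin> tbox_constants T"
  shows "module_setting T \<Sigma> (chi_m \<Sigma> c)"
proof -
  have "finite \<Sigma>"
    using assms finite_sig finite_subset by blast
  then have "abox \<Sigma> (star_abox \<Sigma> c)"
    by (auto simp: abox_def star_abox_def is_top_def ground_def vars_def)
  moreover from this have "abox (sig T) (star_abox \<Sigma> c)"
    using assms(2) by (auto simp: abox_def)
  moreover have "constants a \<subseteq> {c}" if "a \<in> star_abox \<Sigma> c" for a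
    using that by (auto simp: star_abox_def constants_def)
  ultimately show ?thesis
    using assms(3) by (force simp: module_setting_def chi_m_def)
qed

end

theory Submission
  imports Defs
begin

text \<open>
  Only predicates matter. Call a predicate reachable if it is derivable from \<open>\<Sigma>\<close> when arguments
  are ignored, and useful if moreover it takes part in a derivation of a predicate of \<open>\<Sigma>\<close>. A model
  of the module becomes a model of \<open>T\<close> by keeping the useful predicates, making the
  remaining reachable predicates full, and emptying all others: a rule outside the module
  has an unreachable predicate in its body, or else all predicates of its head are reachable and
  useless.
\<close>

section \<open>Reachable and useful predicates\<close>

inductive reachable :: "('p, 'c) drule set \<Rightarrow> 'p psym set \<Rightarrow> 'p psym \<Rightarrow> bool" for P \<Sigma> where
  reachable_base: "A \<in> \<Sigma> \<Longrightarrow> reachable P \<Sigma> A"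
| reachable_step: "r \<in> P \<Longrightarrow> (\<And>a B. a \<in> set (dbody r) \<Longrightarrow> B \<in> preds a \<Longrightarrow> reachable P \<Sigma> B) \<Longrightarrow>
    A \<in> preds (dhead r) \<Longrightarrow> reachable P \<Sigma> A"

text \<open>The whole body must be reachable because a rule takes part in a derivation only if all
  its premises are derivable. Body atoms over the truth symbol have no predicate and impose
  nothing.\<close>

inductive useful :: "('p, 'c) drule set \<Rightarrow> 'p psym set \<Rightarrow> 'p psym \<Rightarrow> bool" for P \<Sigma> where
  useful_base: "A \<in> \<Sigma> \<Longrightarrow> useful P \<Sigma> A"
| useful_step: "r \<in> P \<Longrightarrow> (\<And>a B. a \<in> set (dbody r) \<Longrightarrow> B \<in> preds a \<Longrightarrow> reachable P \<Sigma> B) \<Longrightarrow>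
    B \<in> preds (dhead r) \<Longrightarrow> useful P \<Sigma> B \<Longrightarrow> a \<in> set (dbody r) \<Longrightarrow> A \<in> preds a \<Longrightarrow> useful P \<Sigma> A"

lemma preds_subst_atom [simp]: "preds (subst_atom \<sigma> a) = preds a"
  by (cases a) auto

text \<open>Substitutions leave predicate symbols alone, so unification matches premises with body
  atoms predicate by predicate. This is what makes it sound to forget arguments.\<close>

lemma consequence_preds:
  assumes "consequence \<gamma> r \<gamma>s"
  shows "preds \<gamma> = preds (dhead r)" "map preds \<gamma>s = map preds (dbody r)"
proof -
  from assms obtain \<sigma> where len: "length \<gamma>s = length (dbody r)"
    and u: "unifier \<sigma> (zip \<gamma>s (dbody r))" and \<gamma>: "\<gamma> = subst_atom \<sigma> (dhead r)"
    by (auto simp: consequence_def mgu_def)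
  show "preds \<gamma> = preds (dhead r)"
    by (simp add: \<gamma>)
  show "map preds \<gamma>s = map preds (dbody r)"
  proof (rule nth_equalityI)
    fix i assume "i < length (map preds \<gamma>s)"
    then have "(\<gamma>s ! i, dbody r ! i) \<in> set (zip \<gamma>s (dbody r))"
      and i: "i < length \<gamma>s"
      using len by (auto simp: set_zip)
    with u have "subst_atom \<sigma> (\<gamma>s ! i) = subst_atom \<sigma> (dbody r ! i)"
      by (auto simp: unifier_def)
    then have "preds (\<gamma>s ! i) = preds (dbody r ! i)"
      by (metis preds_subst_atom)
    with i len show "map preds \<gamma>s ! i = map preds (dbody r) ! i"
      by simp
  qed (simp add: len)
qed

lemma edges_Node: "edges (Node l bs) = (\<Union>b\<in>set bs. insert (fst b) (edges (snd b)))"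
  by (force simp: fsts.simps snds.simps)

text \<open>Reachability climbs from the leaves; usefulness descends from the root, with the
  reachability of all children as the side condition of \<open>useful_step\<close>. Assumption
  \<open>P\<close> excludes heads over the truth symbol, where usefulness of the label would hold
  vacuously and leave nothing to pass down.\<close>

lemma proof_tree_reachable_useful:
  assumes "proof_tree P \<A> t"
    and \<A>: "\<And>a. a \<in> \<A> \<Longrightarrow> preds a \<subseteq> \<Sigma>"
    and P: "\<And>r. r \<in> P \<Longrightarrow> preds (dhead r) \<noteq> {}"
  shows "(\<forall>A\<in>preds (label t). reachable P \<Sigma> A) \<and>
    ((\<forall>A\<in>preds (label t). useful P \<Sigma> A) \<longrightarrow>
     (\<forall>r\<in>edges t. \<forall>a\<in>set (dbody r). \<forall>A\<in>preds a. useful P \<Sigma> A))"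
  using assms(1)
proof induction
  case (leaf \<gamma>)
  then show ?case
    using \<A> by (auto simp: is_top_def edges_Node intro: reachable_base)
next
  case (inner bs r \<gamma>)
  have \<gamma>: "preds \<gamma> = preds (dhead r)"
    using inner.hyps consequence_preds by blast
  \<comment> \<open>Children and body atoms show the same predicates, so the induction hypotheses
    for the children speak about the body of \<open>r\<close>.\<close>
  have bs: "(\<lambda>b. preds (label (snd b))) ` set bs = preds ` set (dbody r)"
    using arg_cong[OF consequence_preds(2)[OF inner.hyps(5)], of set]
    by (simp add: image_image)
  have reach: "reachable P \<Sigma> B" if "a \<in> set (dbody r)" "B \<in> preds a" for a B
  proof -
    from bs that obtain b where "b \<in> set bs" "preds (label (snd b)) = preds a"
      by (metis (no_types, lifting) imageE imageI)
    with inner.IH that show ?thesis by blast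
  qed
  show ?case
  proof (intro conjI impI)
    show "\<forall>A\<in>preds (label (Node \<gamma> bs)). reachable P \<Sigma> A"
      using reachable_step[OF inner.hyps(2)] reach \<gamma> by auto
  next
    assume "\<forall>A\<in>preds (label (Node \<gamma> bs)). useful P \<Sigma> A"
    with P[OF inner.hyps(2)] \<gamma> obtain B where B: "B \<in> preds (dhead r)" "useful P \<Sigma> B"
      by auto
    have use: "useful P \<Sigma> A" if "a \<in> set (dbody r)" "A \<in> preds a" for a A
      using useful_step[OF inner.hyps(2) _ B] reach that by blast
    have "\<forall>A\<in>preds (label (snd b)). useful P \<Sigma> A" if b: "b \<in> set bs" for b
    proof -
      from bs b obtain a where "a \<in> set (dbody r)" "preds (label (snd b)) = preds a"
        by (metis (no_types, lifting) imageE imageI)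
      then show ?thesis using use by auto
    qed
    with inner.IH use inner.hyps(3)
    show "\<forall>r\<in>edges (Node \<gamma> bs). \<forall>a\<in>set (dbody r). \<forall>A\<in>preds a. useful P \<Sigma> A"
      by (auto simp: edges_Node)
  qed
qed

section \<open>Proof trees over a single constant\<close>

definition star_fact :: "'c \<Rightarrow> 'p psym \<Rightarrow> ('p, 'c) atom" where
  "star_fact c A = Atom A (replicate (arity A) (Const c))"

text \<open>The conditions under which sending every variable to \<open>c\<close> turns a rule into
  a derivation step between facts over \<open>c\<close> alone: no constant that could clash with
  \<open>c\<close>, a head grounded by the body, and a nonempty body, since an inner node of a proof
  tree has at least one child.\<close>

definition star_drule :: "'c \<Rightarrow> ('p, 'c) drule \<Rightarrow> bool" where
  "star_drule c r \<longleftrightarrow> dbody r \<noteq> [] \<and>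
     (\<forall>a\<in>set (dbody r). wf_atom a \<and> constants a = {}) \<and>
     \<not> is_top (dhead r) \<and> wf_atom (dhead r) \<and> constants (dhead r) \<subseteq> {c} \<and>
     vars (dhead r) \<subseteq> (\<Union>a\<in>set (dbody r). vars a)"

lemma subst_atom_replicate:
  assumes "\<And>x. x \<in> vars a \<Longrightarrow> \<sigma> x = Const c" "constants a \<subseteq> {c}"
  shows "map (subst_trm \<sigma>) (args a) = replicate (length (args a)) (Const c)"
proof -
  have "subst_trm \<sigma> t = Const c" if "t \<in> set (args a)" for t
    using assms that by (cases t) (auto simp: vars_def constants_def)
  then show ?thesis
    by (simp add: map_replicate_const[symmetric])
qed

lemma subst_atom_star_fact:
  assumes "\<And>x. x \<in> vars (Atom A ts) \<Longrightarrow> \<sigma> x = Const c" "constants (Atom A ts) \<subseteq> {c}"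
    and "wf_atom (Atom A ts)"
  shows "subst_atom \<sigma> (Atom A ts) = star_fact c A"
  using subst_atom_replicate[OF assms(1,2)] assms(3) by (simp add: star_fact_def)

text \<open>The premises are ground with \<open>c\<close> in place of every variable, so each
  unifier is forced to be \<open>c\<close> on the body variables and is free elsewhere. The head
  variables occur in the body, so the head becomes a fact over \<open>c\<close>.\<close>

lemma consequence_star:
  fixes c :: 'c
  assumes r: "star_drule c r" and A: "A \<in> preds (dhead r)"
    and \<tau>: "\<tau> = (\<lambda>_. Const c)"
  shows "consequence (star_fact c A) r (map (subst_atom \<tau>) (dbody r))"
proof -
  define V where "V = (\<Union>a\<in>set (dbody r). vars a)"
  \<comment> \<open>The constant substitution \<tau> also unifies but is not most general, since it
    binds variables outside the body too.\<close>
  define \<sigma> where "\<sigma> = (\<lambda>x. if x \<in> V then Const c else Var x :: 'c trm)"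
  from r A obtain ts where h: "dhead r = Atom A ts"
    by (cases "dhead r") (auto simp: star_drule_def)
  have V: "vars (Atom A ts) \<subseteq> V"
    using r h by (simp add: star_drule_def V_def)
  have head: "subst_atom \<sigma> (dhead r) = star_fact c A"
    unfolding h by (rule subst_atom_star_fact) (use V r h in \<open>auto simp: \<sigma>_def star_drule_def\<close>)
  \<comment> \<open>After \<tau> the atom is ground, so \<tau>' leaves it alone and the equation
    gives the value of \<tau>' at each variable.\<close>
  have const: "\<tau>' x = Const c"
    if "subst_atom \<tau>' (subst_atom \<tau> a) = subst_atom \<tau>' a" "x \<in> vars a"
    for \<tau>' a x
    using that by (cases a) (auto simp: vars_def \<tau>)
  have body: "subst_atom \<sigma> (subst_atom \<tau> a) = subst_atom \<sigma> a" if a: "a \<in> set (dbody r)" for a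
  proof -
    have "subst_trm \<sigma> (subst_trm \<tau> t) = subst_trm \<sigma> t" if "t \<in> set (args a)" for t
      by (rule trm.exhaust[of t]) (use that a in \<open>auto simp: \<tau> \<sigma>_def V_def vars_def\<close>)
    then show ?thesis
      by (cases a) auto
  qed
  have "mgu \<sigma> (zip (map (subst_atom \<tau>) (dbody r)) (dbody r))"
    unfolding mgu_def
  proof (intro conjI allI impI)
    show "unifier \<sigma> (zip (map (subst_atom \<tau>) (dbody r)) (dbody r))"
      using body by (auto simp: unifier_def set_zip)
  next
    fix \<tau>' assume u: "unifier \<tau>' (zip (map (subst_atom \<tau>) (dbody r)) (dbody r))"
    have "subst_atom \<tau>' (subst_atom \<tau> a) = subst_atom \<tau>' a" if "a \<in> set (dbody r)" for a
    proof -
      from that obtain i where "i < length (dbody r)" "a = dbody r ! i"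
        by (metis in_set_conv_nth)
      then have "(subst_atom \<tau> a, a) \<in> set (zip (map (subst_atom \<tau>) (dbody r)) (dbody r))"
        by (force simp: set_zip)
      with u show ?thesis
        by (auto simp: unifier_def)
    qed
    then have "\<tau>' x = Const c" if "x \<in> V" for x
      using const that by (fastforce simp: V_def)
    \<comment> \<open>\<tau>' itself is the required \<rho>: on \<open>V\<close> both sides are
      \<open>c\<close>, elsewhere \<sigma> is the identity.\<close>
    then have "\<forall>x. \<tau>' x = subst_trm \<tau>' (\<sigma> x)"
      by (simp add: \<sigma>_def)
    then show "\<exists>\<rho>. \<forall>x. \<tau>' x = subst_trm \<rho> (\<sigma> x)"
      by blast
  qed
  moreover have "ground (star_fact c A)"
    by (simp add: star_fact_def ground_def vars_def)
  ultimately show ?thesis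
    using head by (auto simp: consequence_def)
qed

text \<open>Glues subtrees under one application of \<open>r\<close>. The family \<open>F\<close>
  leaves the choice of the subtree for each predicate to the caller, and the last conclusion keeps
  the rules of the chosen subtrees, so that a given rule can be carried into a larger tree.\<close>

lemma proof_tree_star_step:
  fixes c :: 'c
  assumes r: "r \<in> P" "star_drule c r" and A: "A \<in> preds (dhead r)"
    and F: "\<And>a B. a \<in> set (dbody r) \<Longrightarrow> B \<in> preds a \<Longrightarrow>
      proof_tree P \<A> (F B) \<and> label (F B) = star_fact c B"
  obtains t where "proof_tree P \<A> t" "label t = star_fact c A" "r \<in> edges t"
    "\<And>a B. a \<in> set (dbody r) \<Longrightarrow> B \<in> preds a \<Longrightarrow> edges (F B) \<subseteq> edges t"
proof -
  define \<tau> :: "'c subst" where "\<tau> = (\<lambda>_. Const c)"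
  \<comment> \<open>Atoms over the truth symbol get a leaf of their own, as \<open>F\<close>
    supplies trees for predicates only.\<close>
  define G where "G a = (case a of Top ts \<Rightarrow> Node (subst_atom \<tau> a) [] | Atom B ts \<Rightarrow> F B)" for a
  define bs where "bs = map (\<lambda>a. (r, G a)) (dbody r)"
  have G: "proof_tree P \<A> (G a) \<and> label (G a) = subst_atom \<tau> a" if a: "a \<in> set (dbody r)" for a
  proof (cases a)
    case (Top ts)
    have "Var x \<notin> subst_trm \<tau> ` set ts" for x
    proof
      assume "Var x \<in> subst_trm \<tau> ` set ts"
      then obtain t where "subst_trm \<tau> t = Var x" by auto
      then show False by (cases t) (auto simp: \<tau>_def)
    qed
    then show ?thesis
      using Top by (auto simp: G_def is_top_def ground_def vars_def intro: proof_tree.leaf)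
  next
    case (Atom B ts)
    then have "subst_atom \<tau> a = star_fact c B"
      using subst_atom_star_fact[of B ts \<tau> c] r(2) a by (auto simp: star_drule_def \<tau>_def)
    with F[OF a, of B] Atom show ?thesis
      by (simp add: G_def)
  qed
  have "proof_tree P \<A> (Node (star_fact c A) bs)"
  proof (rule proof_tree.inner)
    show "bs \<noteq> []"
      using r(2) by (simp add: bs_def star_drule_def)
    have "map (\<lambda>b. label (snd b)) bs = map (subst_atom \<tau>) (dbody r)"
      using G by (simp add: bs_def)
    then show "consequence (star_fact c A) r (map (\<lambda>b. label (snd b)) bs)"
      using consequence_star[OF r(2) A \<tau>_def] by simp
  qed (use G r in \<open>auto simp: bs_def\<close>)
  moreover have "r \<in> edges (Node (star_fact c A) bs)"
    using r(2) by (cases "dbody r") (auto simp: edges_Node bs_def star_drule_def)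
  moreover have "edges (F B) \<subseteq> edges (Node (star_fact c A) bs)"
    if "a \<in> set (dbody r)" "B \<in> preds a" for a B
  proof -
    from that(2) have "G a = F B"
      by (cases a) (auto simp: G_def)
    with that(1) show ?thesis
      by (auto simp: edges_Node bs_def)
  qed
  ultimately show thesis
    using that by (metis ltree.sel(1))
qed

text \<open>A converse to the first half of \<open>proof_tree_reachable_useful\<close>: with a
  single constant, forgetting arguments loses nothing.\<close>

lemma reachable_proof_tree:
  assumes "reachable P \<Sigma> A" and P: "\<And>r. r \<in> P \<Longrightarrow> star_drule c r"
  shows "\<exists>t. proof_tree P (star_abox \<Sigma> c) t \<and> label t = star_fact c A"
  using assms(1)
proof induction
  case (reachable_base A)
  then have "proof_tree P (star_abox \<Sigma> c) (Node (star_fact c A) [])"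
    by (auto simp: star_abox_def star_fact_def intro: proof_tree.leaf)
  then show ?case
    by (metis ltree.sel(1))
next
  case (reachable_step r A)
  \<comment> \<open>The condition on the body stands inside the existential quantifier, so that
    choice yields one total function \<open>F\<close>.\<close>
  then have "\<forall>B. \<exists>t. \<forall>a\<in>set (dbody r). B \<in> preds a \<longrightarrow>
      proof_tree P (star_abox \<Sigma> c) t \<and> label t = star_fact c B"
    by blast
  then obtain F where "\<forall>B. \<forall>a\<in>set (dbody r). B \<in> preds a \<longrightarrow>
      proof_tree P (star_abox \<Sigma> c) (F B) \<and> label (F B) = star_fact c B"
    by metis
  then show ?case
    using proof_tree_star_step[OF reachable_step(1) P[OF reachable_step(1)] reachable_step.hyps(3)]
    by (metis (no_types, lifting))
qed

text \<open>A tree containing \<open>r\<close> grows upwards until its root lies over \<Sigma>: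
  induction along usefulness hangs it below a rule whose head predicate is one step closer to
  \<Sigma>.\<close>

lemma useful_edges_support:
  assumes "useful P \<Sigma> A" and P: "\<And>r. r \<in> P \<Longrightarrow> star_drule c r"
    and "proof_tree P (star_abox \<Sigma> c) t" "label t = star_fact c A" "r \<in> edges t"
  shows "\<exists>\<gamma>\<in>star_abox \<Sigma> c. r \<in> fact_support \<gamma> P (star_abox \<Sigma> c)"
  using assms(1,3-)
proof (induction arbitrary: t)
  case (useful_base A)
  then show ?case
    by (auto simp: star_abox_def star_fact_def fact_support_def)
next
  case (useful_step s B a A)
  obtain F where F: "\<And>B. reachable P \<Sigma> B \<Longrightarrow>
      proof_tree P (star_abox \<Sigma> c) (F B) \<and> label (F B) = star_fact c B"
    using reachable_proof_tree[OF _ P] by metis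
  \<comment> \<open>\<open>F(A := t)\<close> uses the given tree at \<open>A\<close>, which occurs
    in the body of \<open>s\<close> through \<open>a\<close>, and arbitrary trees at the other
    predicates.\<close>
  have "proof_tree P (star_abox \<Sigma> c) ((F(A := t)) B) \<and> label ((F(A := t)) B) = star_fact c B"
    if "a \<in> set (dbody s)" "B \<in> preds a" for a B
    using that F useful_step.hyps(2) useful_step.prems by auto
  then obtain t' where t': "proof_tree P (star_abox \<Sigma> c) t'" "label t' = star_fact c B"
    "\<And>a B. a \<in> set (dbody s) \<Longrightarrow> B \<in> preds a \<Longrightarrow> edges ((F(A := t)) B) \<subseteq> edges t'"
    using proof_tree_star_step[OF useful_step.hyps(1) P[OF useful_step.hyps(1)] useful_step.hyps(3)]
    by (metis (no_types, lifting))
  have "r \<in> edges t'"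
    using t'(3)[OF useful_step.hyps(5,6)] useful_step.prems(3) by auto
  with t' useful_step.IH show ?case
    by blast
qed

section \<open>The datalog rules of a TBox rule\<close>

text \<open>All existential variables become \<open>c\<close>, the only constant to appear, and
  safety of \<open>r\<close> covers the remaining head variables. An empty head becomes
  \<open>Bot\<close> without arguments.\<close>

lemma star_drule_corresponding:
  fixes c :: 'c
  assumes r: "wf_rule r" and const: "\<And>a. a \<in> rule_atoms r \<Longrightarrow> constants a = {}"
    and d: "d \<in> corresponding (\<lambda>_. c) r"
  shows "star_drule c d"
proof -
  have body: "dbody d = body r"
    using d by (auto simp: corresponding_def split: if_splits)
  have "\<not> is_top (dhead d) \<and> wf_atom (dhead d) \<and> constants (dhead d) \<subseteq> {c} \<and>
      vars (dhead d) \<subseteq> (\<Union>a\<in>set (body r). vars a)"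
  proof (cases "head r = []")
    case True
    with d show ?thesis
      by (auto simp: corresponding_def is_top_def constants_def vars_def)
  next
    case False
    with d obtain \<gamma> where \<gamma>: "\<gamma> \<in> head_atoms r" and h: "dhead d = inst (\<lambda>_. c) r \<gamma>"
      by (auto simp: corresponding_def)
    from \<gamma> r have wf: "wf_atom \<gamma>" "\<not> is_top \<gamma>"
      and safe: "vars \<gamma> - set (evars r) \<subseteq> (\<Union>a\<in>set (body r). vars a)"
      by (auto simp: wf_rule_def rule_atoms_def safe_def body_atoms_def)
    then obtain A ts where A: "\<gamma> = Atom A ts"
      by (cases \<gamma>) (auto simp: is_top_def)
    define \<sigma> where "\<sigma> = (\<lambda>x. if x \<in> set (evars r) then Const c else Var x :: 'c trm)"
    have ts: "t \<in> Var ` vars \<gamma>" if "t \<in> set ts" for t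
      using const[of \<gamma>] \<gamma> A that by (cases t) (auto simp: rule_atoms_def constants_def vars_def)
    have h': "dhead d = Atom A (map (subst_trm \<sigma>) ts)"
      by (simp add: h A inst_def \<sigma>_def)
    have \<sigma>: "subst_trm \<sigma> t \<in> insert (Const c) (Var ` (vars \<gamma> - set (evars r)))"
      if "t \<in> set ts" for t
      using ts[OF that] by (cases t) (auto simp: \<sigma>_def)
    have "constants (dhead d) \<subseteq> {c}" "vars (dhead d) \<subseteq> vars \<gamma> - set (evars r)"
      using \<sigma> by (fastforce simp: h' constants_def vars_def[of "Atom _ (map _ _)"])+
    then show ?thesis
      using wf safe by (auto simp: h' A is_top_def)
  qed
  then show ?thesis
    using r const body by (auto simp: star_drule_def wf_rule_def rule_atoms_def body_atoms_def)
qed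

text \<open>Every atom of every disjunct has its own datalog rule, so disjunction plays no part in
  what is reachable.\<close>

lemma head_preds_corresponding:
  assumes "a \<in> head_atoms r" "A \<in> preds a"
  shows "\<exists>d\<in>corresponding \<theta> r. dbody d = body r \<and> A \<in> preds (dhead d)"
proof (intro bexI conjI)
  show "DRule (body r) (inst \<theta> r a) \<in> corresponding \<theta> r"
    using assms(1) by (auto simp: corresponding_def head_atoms_def)
qed (use assms(2) in \<open>auto simp: inst_def\<close>)

section \<open>Truth of atoms in full and in agreeing interpretations\<close>

lemma sat_atom_full:
  assumes "wf_atom a" "interpretation_wf I" "range \<nu> \<subseteq> Dom I"
    and "\<And>A. A \<in> preds a \<Longrightarrow> pint I A = {ds. set ds \<subseteq> Dom I \<and> length ds = arity A}"
  shows "sat_atom I \<nu> a"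
proof (cases a)
  case (Atom A ts)
  have "val I \<nu> t \<in> Dom I" for t
    using assms(2,3) by (cases t) (auto simp: interpretation_wf_def)
  with Atom assms(1,4) show ?thesis
    by auto
qed simp

lemma sat_atom_cong:
  assumes "cint J = cint I" "\<And>A. A \<in> preds a \<Longrightarrow> pint J A = pint I A"
  shows "sat_atom J \<nu> a \<longleftrightarrow> sat_atom I \<nu> a"
proof -
  have "val J \<nu> = val I \<nu>"
  proof
    fix t show "val J \<nu> t = val I \<nu> t"
      by (cases t) (auto simp: assms(1))
  qed
  then show ?thesis
    by (cases a) (auto simp: assms(2))
qed

section \<open>Extending models of the module to models of the TBox\<close>

theorem theorem9:
  fixes T :: "('p, 'c) rule set" and \<Sigma> :: "'p psym set" and star :: 'c
  assumes "tbox T"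
    and "tbox_constants T = {}"
    and "evars_apart T"
    and "is_signature \<Sigma>" and "\<Sigma> \<subseteq> sig T"
    and "star \<notin> tbox_constants T"
  shows "model_inseparable TYPE('d) \<Sigma> (module_of T (chi_m \<Sigma> star)) T"
proof -
  let ?M = "module_of T (chi_m \<Sigma> star)"
  define P where "P = program T (chi_m \<Sigma> star)"
  define R where "R = reachable P \<Sigma>"
  define U where "U = useful P \<Sigma>"
  have wf: "wf_rule r" if "r \<in> T" for r
    using that assms(1) by (simp add: tbox_def)
  have corr_P: "corresponding (\<lambda>_. star) r \<subseteq> P" if "r \<in> T" for r
    using that by (auto simp: P_def program_def chi_m_def)
  have star: "star_drule star d" if "d \<in> P" for d
  proof -
    from that obtain r where r: "r \<in> T" "d \<in> corresponding (\<lambda>_. star) r"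
      by (auto simp: P_def program_def chi_m_def)
    then show ?thesis
      using star_drule_corresponding[OF wf[OF r(1)] _ r(2)] assms(2)
      by (auto simp: tbox_constants_def)
  qed
  have supp: "setting_support T (chi_m \<Sigma> star) =
      {d \<in> P. \<exists>\<gamma>\<in>star_abox \<Sigma> star. d \<in> fact_support \<gamma> P (star_abox \<Sigma> star)}"
    by (simp add: setting_support_def P_def chi_m_def)
  have module: "r \<in> ?M \<longleftrightarrow>
      r \<in> T \<and> (\<exists>d\<in>corresponding (\<lambda>_. star) r. \<exists>\<gamma>\<in>star_abox \<Sigma> star.
        d \<in> fact_support \<gamma> P (star_abox \<Sigma> star))" for r
    using corr_P by (auto simp: module_of_def supp) (auto simp: chi_m_def)
  have dbody: "dbody d = body r" if "d \<in> corresponding \<theta> r" for d r and \<theta> :: "var \<Rightarrow> 'c"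
    using that by (auto simp: corresponding_def split: if_splits)
  \<comment> \<open>Membership in the module is witnessed by a tree with a fact over \<Sigma> at its
    root; usefulness descends from there to the body of \<open>d\<close>, which is that of
    \<open>r\<close>.\<close>
  have body_useful: "U A" if r: "r \<in> ?M" and a: "a \<in> set (body r)" "A \<in> preds a" for r a A
  proof -
    from r obtain d \<gamma> t where d: "d \<in> corresponding (\<lambda>_. star) r"
      and \<gamma>: "\<gamma> \<in> star_abox \<Sigma> star"
      and t: "proof_tree P (star_abox \<Sigma> star) t" "label t = \<gamma>" "d \<in> edges t"
      by (auto simp: module fact_support_def)
    have "\<forall>A\<in>preds (label t). useful P \<Sigma> A"
      using \<gamma> t(2) by (auto simp: star_abox_def intro: useful_base)
    moreover have "preds (dhead d) \<noteq> {}" if "d \<in> P" for d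
      using star[OF that] by (cases "dhead d") (auto simp: star_drule_def is_top_def)
    ultimately have "\<forall>d\<in>edges t. \<forall>a\<in>set (dbody d). \<forall>A\<in>preds a. useful P \<Sigma> A"
      using proof_tree_reachable_useful[OF t(1), of \<Sigma>] by (fastforce simp: star_abox_def)
    then show ?thesis
      using t(3) dbody[OF d] a by (auto simp: U_def)
  qed
  have head_reach: "R A" if "r \<in> T" "\<And>a B. a \<in> set (body r) \<Longrightarrow> B \<in> preds a \<Longrightarrow> R B"
    "a \<in> head_atoms r" "A \<in> preds a" for r a A
  proof -
    from head_preds_corresponding[OF that(3,4)] obtain d
      where d: "d \<in> corresponding (\<lambda>_. star) r" "dbody d = body r" "A \<in> preds (dhead d)"
      by blast
    with corr_P[OF that(1)] that(2) show ?thesis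
      unfolding R_def by (metis reachable_step subsetD)
  qed
  \<comment> \<open>Used in contrapositive for rules outside the module. A tree for \<open>A\<close>
    with \<open>d\<close> at its root exists since the body is reachable, and usefulness of
    \<open>A\<close> extends it to a root over \<Sigma>.\<close>
  have supported: "r \<in> ?M" if r: "r \<in> T"
    and body: "\<And>a B. a \<in> set (body r) \<Longrightarrow> B \<in> preds a \<Longrightarrow> R B"
    and d: "d \<in> corresponding (\<lambda>_. star) r" "A \<in> preds (dhead d)" "U A" for r d A
  proof -
    have dP: "d \<in> P"
      using d(1) corr_P[OF r] by blast
    obtain F where "\<And>B. R B \<Longrightarrow>
        proof_tree P (star_abox \<Sigma> star) (F B) \<and> label (F B) = star_fact star B"
      using reachable_proof_tree[OF _ star] unfolding R_def by metis
    then obtain t where "proof_tree P (star_abox \<Sigma> star) t" "label t = star_fact star A"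
      "d \<in> edges t"
      using proof_tree_star_step[OF dP star[OF dP] d(2)] body dbody[OF d(1)]
      by (metis (no_types, lifting))
    then show ?thesis
      using useful_edges_support[OF _ star] d r unfolding module U_def by blast
  qed
  have reach_useful: "R A" if "U A" for A
    using that unfolding U_def R_def by (cases rule: useful.cases) (auto intro: reachable_base)
  have ext: "\<exists>J :: ('p, 'c, 'd) interp. is_model J T \<and> Dom J = Dom I \<and> (\<forall>A\<in>\<Sigma>. pint I A = pint J A)"
    if I: "is_model I ?M" for I :: "('p, 'c, 'd) interp"
  proof -
    define full where "full A = {ds. set ds \<subseteq> Dom I \<and> length ds = arity A}" for A :: "'p psym"
    define J :: "('p, 'c, 'd) interp" where "J = \<lparr>Dom = Dom I, cint = cint I,
      pint = (\<lambda>A. if U A then pint I A else if R A then full A else {})\<rparr>"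
    have J [simp]: "Dom J = Dom I" "cint J = cint I"
      "pint J A = (if U A then pint I A else if R A then full A else {})" for A
      by (simp_all add: J_def)
    have U\<Sigma>: "U A" if "A \<in> \<Sigma>" for A
      using that by (simp add: U_def useful_base)
    \<comment> \<open>\<open>Bot\<close> lies in \<Sigma> and so keeps its empty extension; filling
      it would violate \<open>interpretation_wf\<close>.\<close>
    have UBot: "U Bot"
      using assms(4) U\<Sigma> by (simp add: is_signature_def)
    have wfI: "interpretation_wf I"
      using I by (simp add: is_model_def)
    have wfJ: "interpretation_wf J"
      using wfI UBot by (auto simp: interpretation_wf_def full_def)
    have "sat_rule J r" if r: "r \<in> T" for r
      unfolding sat_rule_def
    proof (intro allI impI)
      fix \<nu> assume \<nu>: "range \<nu> \<subseteq> Dom J" and body: "\<forall>a\<in>set (body r). sat_atom J \<nu> a"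
      \<comment> \<open>A predicate that is not reachable is not useful either, hence empty in
        \<open>J\<close>, and would falsify the body.\<close>
      have R: "R B" if "a \<in> set (body r)" "B \<in> preds a" for a B
      proof (rule ccontr)
        assume "\<not> R B"
        with reach_useful have "pint J B = {}" by auto
        with that(2) have "\<not> sat_atom J \<nu> a"
          by (cases a) (auto simp del: J)
        with that(1) body show False by blast
      qed
      have wf_head: "wf_atom a" if "a \<in> head_atoms r" for a
        using wf[OF r] that by (auto simp: wf_rule_def rule_atoms_def)
      \<comment> \<open>Truth in \<open>I\<close> is asked only for useful predicates, as the other
        head predicates are full in \<open>J\<close>. This serves module rules through
        \<open>I\<close>, and rules outside the module vacuously.\<close>
      have head: "sat_atom J \<mu> a"
        if a: "a \<in> head_atoms r" and \<mu>: "range \<mu> \<subseteq> Dom I"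
          and U: "\<And>A. A \<in> preds a \<Longrightarrow> U A \<Longrightarrow> sat_atom I \<mu> a" for a \<mu>
      proof (cases "\<exists>A\<in>preds a. U A")
        case True
        then have "\<forall>A\<in>preds a. U A"
          by (cases a) auto
        with U True show ?thesis
          by (subst sat_atom_cong[of J I]) auto
      next
        case False
        show ?thesis
          by (rule sat_atom_full[OF wf_head[OF a] wfJ])
            (use \<mu> False head_reach[OF r _ a] R in \<open>auto simp: full_def\<close>)
      qed
      show "\<exists>\<mu>. range \<mu> \<subseteq> Dom J \<and> (\<forall>x. x \<notin> set (evars r) \<longrightarrow> \<mu> x = \<nu> x) \<and>
          (\<exists>\<psi>\<in>set (head r). \<forall>a\<in>set \<psi>. sat_atom J \<mu> a)"
      proof (cases "r \<in> ?M")
        case True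
        \<comment> \<open>Body predicates of a module rule are useful, so \<open>I\<close> and
          \<open>J\<close> agree on the body and \<open>I\<close> supplies the witnesses.\<close>
        have "sat_atom I \<nu> a" if "a \<in> set (body r)" for a
          using body that body_useful[OF True that] sat_atom_cong[of J I a \<nu>] by auto
        moreover have "sat_rule I r"
          using I True by (simp add: is_model_def)
        ultimately obtain \<mu> \<psi> where \<mu>: "range \<mu> \<subseteq> Dom I" "\<forall>x. x \<notin> set (evars r) \<longrightarrow> \<mu> x = \<nu> x"
          and \<psi>: "\<psi> \<in> set (head r)" "\<forall>a\<in>set \<psi>. sat_atom I \<mu> a"
          using \<nu> unfolding sat_rule_def J by blast
        have "set \<psi> \<subseteq> head_atoms r"
          using \<psi>(1) by (auto simp: head_atoms_def)
        then have "\<forall>a\<in>set \<psi>. sat_atom J \<mu> a"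
          using head \<mu>(1) \<psi>(2) by blast
        with \<mu> \<psi>(1) show ?thesis
          by auto
      next
        case False
        have "\<not> U A" if a: "a \<in> head_atoms r" "A \<in> preds a" for a A
        proof
          assume U: "U A"
          obtain d where d: "d \<in> corresponding (\<lambda>_. star) r" "A \<in> preds (dhead d)"
            using head_preds_corresponding[OF a] by blast
          have "r \<in> ?M"
            by (rule supported[OF r _ d U]) (rule R)
          with False show False by contradiction
        qed
        \<comment> \<open>All head atoms are over full predicates and hold under any assignment, so
          \<nu> itself serves as \<mu> and any disjunct will do.\<close>
        then have "\<forall>a\<in>head_atoms r. sat_atom J \<nu> a"
          using head \<nu> by auto
        \<comment> \<open>With an empty head the corresponding rule would derive \<open>Bot\<close>,
          which is useful, and \<open>r\<close> would lie in the module.\<close>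
        moreover have "head r \<noteq> []"
        proof
          assume "head r = []"
          then have d: "DRule (body r) (Atom Bot []) \<in> corresponding (\<lambda>_. star) r"
            by (simp add: corresponding_def)
          have "r \<in> ?M"
            by (rule supported[OF r _ d _ UBot]) (use R in auto)
          with False show False by contradiction
        qed
        then have "hd (head r) \<in> set (head r)"
          by simp
        ultimately show ?thesis
          using \<nu> by (intro exI[of _ \<nu>]) (auto simp: head_atoms_def)
      qed
    qed
    with wfJ have "is_model J T"
      by (simp add: is_model_def)
    moreover have "\<forall>A\<in>\<Sigma>. pint I A = pint J A"
      using U\<Sigma> by simp
    ultimately show ?thesis
      using J(1) by blast
  qed
  \<comment> \<open>The module is a subset of \<open>T\<close>, so in this direction the model
    itself is the witness.\<close>
  have "is_model I ?M" if "is_model I T" for I :: "('p, 'c, 'd) interp"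
    using that by (auto simp: is_model_def module_of_def)
  with ext show ?thesis
    unfolding model_inseparable_def by blast
qed

end
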